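(* Let $n\ge 0$ and $m$ be integers with $0<m\le 2^n$. Then the pattern $R_{m,m}$ is similar to the section $H_{n,m}$ (identifying the plane $\{z=1-m/2^n\}$ with $\mathbb{R}^2$), i.e. there is a similarity transformation of the plane mapping one onto the other.
   Context: Chocolate game: for a positive integer $m$, $C_{m,m}$ is a two-player impartial game on an $m\times m$ chocolate bar of unit cells, one of which is poisoned (known to both players); cells are $(i,j)\in\mathbb{Z}^2$, $1\le i,j\le m$. Players alternately break the current bar along a grid line into two rectangles, eat one and pass the other (always keeping the poisoned cell); a player who receives the $1\times 1$ bar loses. A cell is a P-position if with poison there the second player has a winning strategy; $P_{m,m}$ is the set of P-positions. It is known that $(i,j)\in P_{m,m}$ iff $(i-1)\oplus(j-1)\oplus(m-i)\oplus(m-j)=0$ ($\oplus$ = bitwise XOR). The pattern is $R_{m,m}=\{(i-x,j-y)\in\mathbb{R}^2: 0\le x,y\le 1,\ (i,j)\in P_{m,m}\}$. Sierpiński octahedron: the operation $T$ on a regular octahedron with center $O$ removes, for each of its eight faces, the tetrahedron spanned by $O$ and the three midpoints of the edges of that face; what remains is six regular octahedra of half the edge length (one at each vertex). Let $S_0$ be the regular octahedron with vertices $(\pm1,0,0),(0,\pm1,0),(0,0,\pm1)$, and let $S_{n}$ be obtained by applying $T$ to each of the octahedra of $S_{n-1}$; thus $S_n$ is a union of $6^n$ regular octahedra of edge length $\sqrt2/2^n$. For an integer $m$, $H_{n,m}=S_n\cap\{z=1-m/2^n\}$. *)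

theory Defs
  imports "HOL-Analysis.Analysis"
begin

subsection \<open>The chocolate game\<close>

type_synonym cell = "int \<times> int"
type_synonym bar = "cell set"

definition bar_square :: "int \<Rightarrow> bar" where
  "bar_square m = {1..m} \<times> {1..m}"

definition breaks_into :: "bar \<Rightarrow> bar \<Rightarrow> bar \<Rightarrow> bool" where
  "breaks_into B X Y \<longleftrightarrow> X \<noteq> {} \<and> Y \<noteq> {} \<and>
     (\<exists>k. X = {c \<in> B. fst c \<le> k} \<and> Y = {c \<in> B. k < fst c} \<or>
          X = {c \<in> B. snd c \<le> k} \<and> Y = {c \<in> B. k < snd c})"

text \<open>\<open>move p B B'\<close>: a player who receives the bar \<open>B\<close>, with poisoned cell \<open>p\<close>, may pass on \<open>B'\<close>.\<close>

definition move :: "cell \<Rightarrow> bar \<Rightarrow> bar \<Rightarrow> bool" where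
  "move p B B' \<longleftrightarrow> p \<in> B' \<and> (\<exists>E. breaks_into B B' E \<or> breaks_into B E B')"

text \<open>
  A strategy \<open>\<sigma>\<close> tells the second player which bar to pass on after receiving a given bar.
  \<open>second_player_wins p \<sigma> B\<close> holds iff, with the first player to move on \<open>B\<close>, every reply
  prescribed by \<open>\<sigma>\<close> is legal and the play always ends with the first player unable to move.
  The only bar containing \<open>p\<close> that admits no move is the \<open>1 \<times> 1\<close> bar \<open>{p}\<close>, whose
  receiver loses. Since the available moves depend only on the current bar and every play is
  finite, strategies that look only at the current bar suffice.
\<close>

inductive second_player_wins :: "cell \<Rightarrow> (bar \<Rightarrow> bar) \<Rightarrow> bar \<Rightarrow> bool"
  for p :: cell and \<sigma> :: "bar \<Rightarrow> bar" where
  "(\<And>B'. move p B B' \<Longrightarrow> move p B' (\<sigma> B') \<and> second_player_wins p \<sigma> (\<sigma> B'))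
     \<Longrightarrow> second_player_wins p \<sigma> B"

definition P_positions :: "int \<Rightarrow> cell set" where
  "P_positions m = {p \<in> bar_square m. \<exists>\<sigma>. second_player_wins p \<sigma> (bar_square m)}"

definition game_pattern :: "int \<Rightarrow> (real \<times> real) set" where
  "game_pattern m = {(of_int i - x, of_int j - y) | i j x y.
     (i, j) \<in> P_positions m \<and> 0 \<le> x \<and> x \<le> 1 \<and> 0 \<le> y \<and> y \<le> 1}"


subsection \<open>The Sierpinski octahedron\<close>

type_synonym point3 = "real \<times> real \<times> real"

text \<open>
  All octahedra that occur are axis-parallel: \<open>octahedron c r\<close> has centre \<open>c\<close> and vertices
  \<open>c \<plusminus> r e\<close>, where \<open>e\<close> ranges over the three standard basis vectors; its edge length is
  \<open>r * sqrt 2\<close>.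
\<close>

definition octahedron :: "point3 \<Rightarrow> real \<Rightarrow> point3 set" where
  "octahedron c r = convex hull {c + (t * r) *\<^sub>R e | t e. t \<in> {-1, 1} \<and> e \<in> Basis}"

text \<open>
  The faces correspond to the sign choices \<open>s\<close>: the face given by \<open>s\<close> has the three vertices
  \<open>face_vertex c r s e\<close>, where \<open>e\<close> ranges over \<open>Basis\<close>.
\<close>

definition face_signs :: "(point3 \<Rightarrow> real) set" where
  "face_signs = {s. \<forall>e\<in>Basis. s e \<in> {-1, 1}}"

definition face_vertex :: "point3 \<Rightarrow> real \<Rightarrow> (point3 \<Rightarrow> real) \<Rightarrow> point3 \<Rightarrow> point3" where
  "face_vertex c r s e = c + (s e * r) *\<^sub>R e"

definition face_tetrahedron :: "point3 \<Rightarrow> real \<Rightarrow> (point3 \<Rightarrow> real) \<Rightarrow> point3 set" where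
  "face_tetrahedron c r s = convex hull (insert c
     {midpoint (face_vertex c r s e) (face_vertex c r s e') | e e'.
        e \<in> Basis \<and> e' \<in> Basis \<and> e \<noteq> e'})"

text \<open>
  The operation \<open>T\<close>. The closure restores the boundary points that the remaining (closed)
  octahedra share with the removed tetrahedra, see \<open>T_octahedron_eq\<close> below.
\<close>

definition T_octahedron :: "point3 \<Rightarrow> real \<Rightarrow> point3 set" where
  "T_octahedron c r = closure (octahedron c r - (\<Union>s\<in>face_signs. face_tetrahedron c r s))"

text \<open>Centres and radii of the six octahedra that remain, one at each vertex.\<close>

definition remaining_octahedra :: "point3 \<Rightarrow> real \<Rightarrow> (point3 \<times> real) set" where
  "remaining_octahedra c r = {(midpoint c (c + (t * r) *\<^sub>R e), r / 2) | t e. t \<in> {-1, 1} \<and> e \<in> Basis}"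

primrec sierpinski_octahedra :: "nat \<Rightarrow> (point3 \<times> real) set" where
  "sierpinski_octahedra 0 = {(0, 1)}"
| "sierpinski_octahedra (Suc n) = (\<Union>(c, r)\<in>sierpinski_octahedra n. remaining_octahedra c r)"

primrec sierpinski :: "nat \<Rightarrow> point3 set" where
  "sierpinski 0 = octahedron 0 1"
| "sierpinski (Suc n) = (\<Union>(c, r)\<in>sierpinski_octahedra n. T_octahedron c r)"

definition horizontal_section :: "nat \<Rightarrow> int \<Rightarrow> (real \<times> real) set" where
  "horizontal_section n m = {(x, y). (x, y, 1 - of_int m / 2 ^ n) \<in> sierpinski n}"


subsection \<open>Similarity\<close>

definition similarity :: "('a::metric_space \<Rightarrow> 'a) \<Rightarrow> bool" where
  "similarity f \<longleftrightarrow> bij f \<and> (\<exists>k>0. \<forall>x y. dist (f x) (f y) = k * dist x y)"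

definition similar :: "'a::metric_space set \<Rightarrow> 'a set \<Rightarrow> bool" where
  "similar A B \<longleftrightarrow> (\<exists>f. similarity f \<and> f ` A = B)"


subsection \<open>The octahedra remaining after \<open>T\<close>\<close>

lemma Basis_point3: "(Basis :: point3 set) = {(1, 0, 0), (0, 1, 0), (0, 0, 1)}"
  by (auto simp: Basis_prod_def zero_prod_def)

lemma octahedron_eq:
  assumes r: "r > 0"
  shows "octahedron (a, b, c) r = {(x, y, z). \<bar>x - a\<bar> + \<bar>y - b\<bar> + \<bar>z - c\<bar> \<le> r}" (is "?L = ?R")
proof
  have conv: "convex ?R"
  proof (rule convexI)
    fix p q :: point3 and u v :: real
    assume h: "p \<in> ?R" "q \<in> ?R" "0 \<le> u" "0 \<le> v" "u + v = 1"
    obtain x y z x' y' z' where pq: "p = (x, y, z)" "q = (x', y', z')" by (cases p, cases q) auto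
    have v: "v = 1 - u" using h(5) by simp
    have tri: "\<bar>(u * s + v * t) - d\<bar> \<le> u * \<bar>s - d\<bar> + v * \<bar>t - d\<bar>" for s t d
    proof -
      have "u * s + v * t - d = u * (s - d) + v * (t - d)"
        unfolding v by (simp add: algebra_simps)
      also have "\<bar>\<dots>\<bar> \<le> \<bar>u * (s - d)\<bar> + \<bar>v * (t - d)\<bar>" by (rule abs_triangle_ineq)
      finally show ?thesis using h by (simp add: abs_mult)
    qed
    have "u * (\<bar>x - a\<bar> + \<bar>y - b\<bar> + \<bar>z - c\<bar>) + v * (\<bar>x' - a\<bar> + \<bar>y' - b\<bar> + \<bar>z' - c\<bar>) \<le> u * r + v * r"
      using h pq by (intro add_mono mult_left_mono) auto
    also have "\<dots> = r" using h(5) by (metis distrib_right mult_1)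
    finally show "u *\<^sub>R p + v *\<^sub>R q \<in> ?R"
      using tri[of x x' a] tri[of y y' b] tri[of z z' c] pq by (simp add: algebra_simps)
  qed
  show "?L \<subseteq> ?R"
    unfolding octahedron_def
    by (rule hull_minimal[where S = convex, OF _ conv]) (use r in \<open>auto simp: Basis_point3\<close>)
  show "?R \<subseteq> ?L"
  proof
    fix p assume "p \<in> ?R"
    then obtain x y z where p: "p = (x, y, z)" and le: "\<bar>x - a\<bar> + \<bar>y - b\<bar> + \<bar>z - c\<bar> \<le> r" by auto
    define V where "V = {(a, b, c) + (t * r) *\<^sub>R e | t e. t \<in> {-1, 1} \<and> e \<in> (Basis :: point3 set)}"
    have V: "(a + t * r, b, c) \<in> convex hull V" "(a, b + t * r, c) \<in> convex hull V"
      "(a, b, c + t * r) \<in> convex hull V" if "t \<in> {-1, 1}" for t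
    proof -
      have "(a, b, c) + (t * r) *\<^sub>R e \<in> convex hull V" if "e \<in> Basis" for e
        unfolding V_def using \<open>t \<in> {-1, 1}\<close> that by (intro hull_inc) blast
      from this[of "(1,0,0)"] this[of "(0,1,0)"] this[of "(0,0,1)"]
      show "(a + t * r, b, c) \<in> convex hull V" "(a, b + t * r, c) \<in> convex hull V"
        "(a, b, c + t * r) \<in> convex hull V" by (simp_all add: Basis_point3)
    qed
    have cen: "(a, b, c) \<in> convex hull V"
      using convexD[OF convex_convex_hull V(1)[of 1] V(1)[of "-1"], of "1/2" "1/2"]
      by (simp add: field_simps)
    define s where "s = (\<lambda>d::real. if d \<ge> 0 then 1 else - 1 :: real)"
    have s: "s d \<in> {-1, 1}" "\<bar>d\<bar> * s d = d" for d by (auto simp: s_def)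
    define P where "P = (\<lambda>i::nat. if i = 0 then (a, b, c) else if i = 1 then (a + s (x - a) * r, b, c)
       else if i = 2 then (a, b + s (y - b) * r, c) else (a, b, c + s (z - c) * r))"
    define w where "w = (\<lambda>i::nat. if i = 0 then 1 - (\<bar>x - a\<bar> + \<bar>y - b\<bar> + \<bar>z - c\<bar>) / r
       else if i = 1 then \<bar>x - a\<bar> / r else if i = 2 then \<bar>y - b\<bar> / r else \<bar>z - c\<bar> / r)"
    have "(\<Sum>i\<in>{0,1,2,3}. w i *\<^sub>R P i) \<in> convex hull V"
    proof (rule convex_sum)
      show "(\<Sum>i\<in>{0,1,2,3}. w i) = 1" by (simp add: w_def add_divide_distrib)
      show "w i \<ge> 0" for i using r le by (simp add: w_def)
      show "P i \<in> convex hull V" for i using V s cen by (auto simp: P_def)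
    qed auto
    also have "(\<Sum>i\<in>{0,1,2,3}. w i *\<^sub>R P i) = p"
    proof -
      have m: "\<bar>d\<bar> * (s d * r) / r = d" for d using s(2)[of d] r by simp
      show ?thesis using m[of "x - a"] m[of "y - b"] m[of "z - c"]
        by (simp add: w_def P_def p algebra_simps add_divide_distrib diff_divide_distrib)
    qed
    finally show "p \<in> ?L" by (simp add: V_def octahedron_def)
  qed
qed

lemma face_tetrahedra_eq:
  assumes r: "r > 0"
  shows "(\<Union>s\<in>face_signs. face_tetrahedron (a, b, c) r s) = {(x, y, z) \<in> octahedron (a, b, c) r.
     \<bar>x - a\<bar> \<le> \<bar>y - b\<bar> + \<bar>z - c\<bar> \<and> \<bar>y - b\<bar> \<le> \<bar>x - a\<bar> + \<bar>z - c\<bar> \<and> \<bar>z - c\<bar> \<le> \<bar>x - a\<bar> + \<bar>y - b\<bar>}"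
  (is "?L = ?R")
proof
  show "?L \<subseteq> ?R"
  proof
    fix p assume "p \<in> ?L"
    then obtain s where s: "s \<in> face_signs" and p: "p \<in> face_tetrahedron (a, b, c) r s" by auto
    obtain s1 s2 s3 where sv: "s1 = s (1,0,0)" "s2 = s (0,1,0)" "s3 = s (0,0,1)" by auto
    have s': "s1 \<in> {-1,1}" "s2 \<in> {-1,1}" "s3 \<in> {-1,1}" using s sv by (auto simp: face_signs_def Basis_point3)
    let ?f = "\<lambda>(x, y, z). (s1 * (x - a), s2 * (y - b), s3 * (z - c))"
    define D where "D = {(x, y, z). 0 \<le> s1 * (x - a) \<and> 0 \<le> s2 * (y - b) \<and> 0 \<le> s3 * (z - c) \<and>
       s1 * (x - a) + s2 * (y - b) + s3 * (z - c) \<le> r \<and>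
       s1 * (x - a) \<le> s2 * (y - b) + s3 * (z - c) \<and> s2 * (y - b) \<le> s1 * (x - a) + s3 * (z - c) \<and>
       s3 * (z - c) \<le> s1 * (x - a) + s2 * (y - b)}"
    have conv: "convex D"
    proof (rule convexI)
      fix p q :: point3 and u v :: real
      assume h: "p \<in> D" "q \<in> D" "0 \<le> u" "0 \<le> v" "u + v = 1"
      obtain x y z x' y' z' where pq: "p = (x, y, z)" "q = (x', y', z')" by (cases p, cases q) auto
      have lin: "t * ((u * d + v * e) - f) = u * (t * (d - f)) + v * (t * (e - f))" for t d e f
      proof -
        have v: "v = 1 - u" using h by simp
        show ?thesis unfolding v by (simp add: algebra_simps)
      qed
      define X Y Z X' Y' Z' where d: "X = s1 * (x - a)" "Y = s2 * (y - b)" "Z = s3 * (z - c)"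
        "X' = s1 * (x' - a)" "Y' = s2 * (y' - b)" "Z' = s3 * (z' - c)"
      have h1: "0 \<le> X" "0 \<le> Y" "0 \<le> Z" "X + Y + Z \<le> r" "X \<le> Y + Z" "Y \<le> X + Z" "Z \<le> X + Y"
        and h2: "0 \<le> X'" "0 \<le> Y'" "0 \<le> Z'" "X' + Y' + Z' \<le> r" "X' \<le> Y' + Z'" "Y' \<le> X' + Z'" "Z' \<le> X' + Y'"
        using h(1,2) pq d by (auto simp: D_def)
      have k: "u * A + v * A' \<le> u * B + v * B'" if "A \<le> B" "A' \<le> B'" for A B A' B'
        using that h by (intro add_mono mult_left_mono)
      have ur: "u * r + v * r = r" using h(5) by (metis distrib_right mult_1)
      note le = k[OF h1(1) h2(1)] k[OF h1(2) h2(2)] k[OF h1(3) h2(3)] k[OF h1(4) h2(4)]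
          k[OF h1(5) h2(5)] k[OF h1(6) h2(6)] k[OF h1(7) h2(7)]
      have e: "s1 * (u * x + v * x' - a) = u * X + v * X'" "s2 * (u * y + v * y' - b) = u * Y + v * Y'"
        "s3 * (u * z + v * z' - c) = u * Z + v * Z'" by (simp_all only: lin d)
      have "(u * x + v * x', u * y + v * y', u * z + v * z') \<in> D"
        unfolding D_def mem_Collect_eq prod.case e
        using le ur unfolding distrib_left mult_zero_right by (intro conjI) linarith+
      then show "u *\<^sub>R p + v *\<^sub>R q \<in> D" unfolding pq by simp
    qed
    have sq: "s1 * (a + s1 * (r / 2) - a) = r / 2" "s2 * (b + s2 * (r / 2) - b) = r / 2"
      "s3 * (c + s3 * (r / 2) - c) = r / 2" using s' by auto
    have fv: "face_vertex (a, b, c) r s (1, 0, 0) = (a + s1 * r, b, c)"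
      "face_vertex (a, b, c) r s (0, 1, 0) = (a, b + s2 * r, c)"
      "face_vertex (a, b, c) r s (0, 0, 1) = (a, b, c + s3 * r)"
      by (simp_all add: face_vertex_def sv)
    have mp: "midpoint (a + s1 * r, b, c) (a, b + s2 * r, c) = (a + s1 * (r / 2), b + s2 * (r / 2), c)"
      "midpoint (a + s1 * r, b, c) (a, b, c + s3 * r) = (a + s1 * (r / 2), b, c + s3 * (r / 2))"
      "midpoint (a, b + s2 * r, c) (a, b, c + s3 * r) = (a, b + s2 * (r / 2), c + s3 * (r / 2))"
      by (simp_all add: midpoint_def field_simps)
    have mp_D: "midpoint (a + s1 * r, b, c) (a, b + s2 * r, c) \<in> D"
      "midpoint (a + s1 * r, b, c) (a, b, c + s3 * r) \<in> D"
      "midpoint (a, b + s2 * r, c) (a, b, c + s3 * r) \<in> D"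
      unfolding mp D_def mem_Collect_eq prod.case sq using r by simp_all
    have gen: "midpoint (face_vertex (a, b, c) r s e) (face_vertex (a, b, c) r s e') \<in> D"
      if "e \<in> Basis" "e' \<in> Basis" "e \<noteq> e'" for e e'
      using that mp_D unfolding Basis_point3
      by (elim insertE emptyE) (simp_all only: fv midpoint_sym not_True_eq_False simp_thms)
    have cen: "(a, b, c) \<in> D" using r by (simp add: D_def)
    have "p \<in> D"
      using p unfolding face_tetrahedron_def
      by (rule rev_subsetD, intro hull_minimal[where S = convex, OF _ conv])
         (use gen cen in blast)
    moreover have "\<bar>d\<bar> = t * d" if "t \<in> {-1,1}" "0 \<le> t * d" for t d :: real using that by auto
    ultimately show "p \<in> ?R" unfolding octahedron_eq[OF r] D_def using s' by auto
  qed
  show "?R \<subseteq> ?L"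
  proof
    fix p assume "p \<in> ?R"
    then obtain x y z where p: "p = (x, y, z)" and le: "\<bar>x - a\<bar> + \<bar>y - b\<bar> + \<bar>z - c\<bar> \<le> r"
      "\<bar>x - a\<bar> \<le> \<bar>y - b\<bar> + \<bar>z - c\<bar>" "\<bar>y - b\<bar> \<le> \<bar>x - a\<bar> + \<bar>z - c\<bar>" "\<bar>z - c\<bar> \<le> \<bar>x - a\<bar> + \<bar>y - b\<bar>"
      by (auto simp: octahedron_eq[OF r])
    define g where "g = (\<lambda>d::real. if d \<ge> 0 then 1 else - 1 :: real)"
    have g: "g d \<in> {-1, 1}" "\<bar>d\<bar> * g d = d" for d by (auto simp: g_def)
    define s where "s = (\<lambda>e::point3. if e = (1,0,0) then g (x - a) else if e = (0,1,0) then g (y - b) else g (z - c))"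
    have sf: "s \<in> face_signs" using g by (auto simp: s_def face_signs_def)
    have gen: "midpoint (face_vertex (a,b,c) r s e) (face_vertex (a,b,c) r s e') \<in> face_tetrahedron (a,b,c) r s"
      if "e \<in> Basis" "e' \<in> Basis" "e \<noteq> e'" for e e'
      unfolding face_tetrahedron_def by (intro hull_inc insertI2 CollectI exI[of _ e] exI[of _ e']) (simp add: that)
    define P where "P = (\<lambda>i::nat. if i = 0 then (a, b, c)
       else if i = 1 then (a + g (x - a) * r / 2, b + g (y - b) * r / 2, c)
       else if i = 2 then (a + g (x - a) * r / 2, b, c + g (z - c) * r / 2)
       else (a, b + g (y - b) * r / 2, c + g (z - c) * r / 2))"
    define X Y Z where d: "X = \<bar>x - a\<bar>" "Y = \<bar>y - b\<bar>" "Z = \<bar>z - c\<bar>"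
    define w where "w = (\<lambda>i::nat. if i = 0 then 1 - (X + Y + Z) / r
       else if i = 1 then (X + Y - Z) / r else if i = 2 then (X + Z - Y) / r else (Y + Z - X) / r)"
    have "(\<Sum>i\<in>{0,1,2,3}. w i *\<^sub>R P i) \<in> face_tetrahedron (a,b,c) r s"
    proof (rule convex_sum)
      show "convex (face_tetrahedron (a,b,c) r s)" unfolding face_tetrahedron_def by (rule convex_convex_hull)
      show "(\<Sum>i\<in>{0,1,2,3}. w i) = 1" using r by (simp add: w_def field_simps)
      show "w i \<ge> 0" for i using r le unfolding w_def d by auto
      have "(a, b, c) \<in> face_tetrahedron (a,b,c) r s"
        unfolding face_tetrahedron_def by (intro hull_inc) auto
      then show "P i \<in> face_tetrahedron (a,b,c) r s" for i
        using gen[of "(1,0,0)" "(0,1,0)"] gen[of "(1,0,0)" "(0,0,1)"] gen[of "(0,1,0)" "(0,0,1)"]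
        by (simp add: P_def s_def Basis_point3 face_vertex_def midpoint_def field_simps)
    qed auto
    also have "(\<Sum>i\<in>{0,1,2,3}. w i *\<^sub>R P i) = p"
    proof -
      have ag: "X * g (x - a) = x - a" "Y * g (y - b) = y - b" "Z * g (z - c) = z - c"
        unfolding d by (rule g(2))+
      have sw: "w 0 + w 1 + w 2 + w 3 = 1" using r by (simp add: w_def field_simps)
      have w: "(w 1 + w 2) * r / 2 = X" "(w 1 + w 3) * r / 2 = Y" "(w 2 + w 3) * r / 2 = Z"
        using r by (simp_all add: w_def field_simps)
      have "w 0 * a + w 1 * (a + g (x - a) * r / 2) + w 2 * (a + g (x - a) * r / 2) + w 3 * a
          = (w 0 + w 1 + w 2 + w 3) * a + ((w 1 + w 2) * r / 2) * g (x - a)"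
        by (simp add: field_simps)
      moreover have "w 0 * b + w 1 * (b + g (y - b) * r / 2) + w 2 * b + w 3 * (b + g (y - b) * r / 2)
          = (w 0 + w 1 + w 2 + w 3) * b + ((w 1 + w 3) * r / 2) * g (y - b)"
        by (simp add: field_simps)
      moreover have "w 0 * c + w 1 * c + w 2 * (c + g (z - c) * r / 2) + w 3 * (c + g (z - c) * r / 2)
          = (w 0 + w 1 + w 2 + w 3) * c + ((w 2 + w 3) * r / 2) * g (z - c)"
        by (simp add: field_simps)
      moreover have "(\<Sum>i\<in>{0,1,2,3}. w i *\<^sub>R P i) =
        (w 0 * a + w 1 * (a + g (x - a) * r / 2) + w 2 * (a + g (x - a) * r / 2) + w 3 * a,
         w 0 * b + w 1 * (b + g (y - b) * r / 2) + w 2 * b + w 3 * (b + g (y - b) * r / 2),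
         w 0 * c + w 1 * c + w 2 * (c + g (z - c) * r / 2) + w 3 * (c + g (z - c) * r / 2))"
        by (simp add: P_def)
      ultimately show ?thesis unfolding sw w ag p by simp
    qed
    finally show "p \<in> ?L" using sf by auto
  qed
qed

lemma T_octahedron_eq:
  assumes r: "r > 0"
  shows "T_octahedron c r = (\<Union>(c', r')\<in>remaining_octahedra c r. octahedron c' r')"
proof -
  obtain a b d where c: "c = (a, b, d)" by (cases c) auto
  let ?O = "octahedron c r"
  let ?U = "\<Union>(c', r')\<in>remaining_octahedra c r. octahedron c' r'"
  define A where "A = ?O - (\<Union>s\<in>face_signs. face_tetrahedron c r s)"
  have A: "A = {(x, y, z). \<bar>x - a\<bar> + \<bar>y - b\<bar> + \<bar>z - d\<bar> \<le> r \<and> (\<bar>y - b\<bar> + \<bar>z - d\<bar> < \<bar>x - a\<bar> \<or>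
     \<bar>x - a\<bar> + \<bar>z - d\<bar> < \<bar>y - b\<bar> \<or> \<bar>x - a\<bar> + \<bar>y - b\<bar> < \<bar>z - d\<bar>)}"
    unfolding A_def c face_tetrahedra_eq[OF r] by (auto simp: octahedron_eq[OF r])
  have rem: "remaining_octahedra c r = {((a + r/2, b, d), r/2), ((a - r/2, b, d), r/2),
      ((a, b + r/2, d), r/2), ((a, b - r/2, d), r/2), ((a, b, d + r/2), r/2), ((a, b, d - r/2), r/2)}"
  proof -
    have gen: "{f t e | t e. t \<in> {-1, 1} \<and> e \<in> (Basis :: point3 set)} =
        {f 1 (1,0,0), f (-1) (1,0,0), f 1 (0,1,0), f (-1) (0,1,0), f 1 (0,0,1), f (-1) (0,0,1)}"
      for f :: "real \<Rightarrow> point3 \<Rightarrow> point3 \<times> real"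
      unfolding Basis_point3 by blast
    show ?thesis unfolding remaining_octahedra_def c gen by (simp add: midpoint_def add_divide_distrib diff_divide_distrib)
  qed
  have r2: "r / 2 > 0" using r by simp
  have U: "?U = {(x, y, z). \<bar>x - a\<bar> + \<bar>y - b\<bar> + \<bar>z - d\<bar> \<le> r \<and> (\<bar>y - b\<bar> + \<bar>z - d\<bar> \<le> \<bar>x - a\<bar> \<or>
     \<bar>x - a\<bar> + \<bar>z - d\<bar> \<le> \<bar>y - b\<bar> \<or> \<bar>x - a\<bar> + \<bar>y - b\<bar> \<le> \<bar>z - d\<bar>)}"
  proof -
    have one: "(\<bar>t - (k + r / 2)\<bar> + l \<le> r / 2 \<or> \<bar>t - (k - r / 2)\<bar> + l \<le> r / 2) \<longleftrightarrow> \<bar>t - k\<bar> + l \<le> r \<and> l \<le> \<bar>t - k\<bar>"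
      if "0 \<le> l" for t k l
      using that r by (auto simp: abs_if field_simps split: if_splits)
    have "(x, y, z) \<in> ?U \<longleftrightarrow>
        (\<bar>x - (a + r / 2)\<bar> + (\<bar>y - b\<bar> + \<bar>z - d\<bar>) \<le> r / 2 \<or> \<bar>x - (a - r / 2)\<bar> + (\<bar>y - b\<bar> + \<bar>z - d\<bar>) \<le> r / 2) \<or>
        (\<bar>y - (b + r / 2)\<bar> + (\<bar>x - a\<bar> + \<bar>z - d\<bar>) \<le> r / 2 \<or> \<bar>y - (b - r / 2)\<bar> + (\<bar>x - a\<bar> + \<bar>z - d\<bar>) \<le> r / 2) \<or>
        (\<bar>z - (d + r / 2)\<bar> + (\<bar>x - a\<bar> + \<bar>y - b\<bar>) \<le> r / 2 \<or> \<bar>z - (d - r / 2)\<bar> + (\<bar>x - a\<bar> + \<bar>y - b\<bar>) \<le> r / 2)" for x y z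
      unfolding rem by (simp add: octahedron_eq[OF r2] ac_simps)
    then have "(x, y, z) \<in> ?U \<longleftrightarrow> \<bar>x - a\<bar> + \<bar>y - b\<bar> + \<bar>z - d\<bar> \<le> r \<and> (\<bar>y - b\<bar> + \<bar>z - d\<bar> \<le> \<bar>x - a\<bar> \<or>
        \<bar>x - a\<bar> + \<bar>z - d\<bar> \<le> \<bar>y - b\<bar> \<or> \<bar>x - a\<bar> + \<bar>y - b\<bar> \<le> \<bar>z - d\<bar>)" for x y z
      unfolding one[OF add_nonneg_nonneg[OF abs_ge_zero abs_ge_zero]] by (simp add: ac_simps) argo
    then show ?thesis by blast
  qed
  have "closed ?U"
  proof -
    have "compact (octahedron c' r')" for c' r'
      unfolding octahedron_def
      by (intro compact_convex_hull finite_imp_compact finite_image_set2) auto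
    then show ?thesis unfolding rem by (simp add: closed_Un compact_imp_closed)
  qed
  moreover have "A \<subseteq> ?U" unfolding A U by auto
  ultimately have "closure A \<subseteq> ?U" by (simp add: closure_minimal)
  moreover have "?U \<subseteq> closure A"
  proof
    fix p assume "p \<in> ?U"
    then obtain c' r' where cr: "(c', r') \<in> remaining_octahedra c r" "p \<in> octahedron c' r'" by blast
    have r': "r' = r / 2" using cr(1) by (auto simp: remaining_octahedra_def)
    obtain c1 c2 c3 where c': "c' = (c1, c2, c3)" by (cases c') auto
    obtain x y z where p: "p = (x, y, z)" by (cases p) auto
    have le: "\<bar>x - c1\<bar> + \<bar>y - c2\<bar> + \<bar>z - c3\<bar> \<le> r / 2"
      using cr(2) unfolding p c' r' octahedron_eq[OF r2] by simp
    have mem: "c1 = a + r / 2 \<and> c2 = b \<and> c3 = d \<or> c1 = a - r / 2 \<and> c2 = b \<and> c3 = d \<or>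
        c1 = a \<and> c2 = b + r / 2 \<and> c3 = d \<or> c1 = a \<and> c2 = b - r / 2 \<and> c3 = d \<or>
        c1 = a \<and> c2 = b \<and> c3 = d + r / 2 \<or> c1 = a \<and> c2 = b \<and> c3 = d - r / 2"
      using cr(1) unfolding rem c' insert_iff empty_iff prod.inject by argo
    have ball: "(u, v, w) \<in> A" if lt: "\<bar>u - c1\<bar> + \<bar>v - c2\<bar> + \<bar>w - c3\<bar> < r / 2" for u v w
    proof -
      have one: "\<bar>t - k\<bar> + l \<le> r \<and> l < \<bar>t - k\<bar>"
        if "\<bar>t - (k + r / 2)\<bar> + l < r / 2 \<or> \<bar>t - (k - r / 2)\<bar> + l < r / 2" for t k l
        using that r by (auto simp: abs_if field_simps split: if_splits)
      show ?thesis unfolding A mem_Collect_eq prod.case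
        using mem lt one[of u a "\<bar>v - b\<bar> + \<bar>w - d\<bar>"] one[of v b "\<bar>u - a\<bar> + \<bar>w - d\<bar>"]
          one[of w d "\<bar>u - a\<bar> + \<bar>v - b\<bar>"]
        by (elim disjE conjE) (simp_all add: ac_simps)
    qed
    have *: "\<bar>x + e * (c1 - x) - c1\<bar> + \<bar>y + e * (c2 - y) - c2\<bar> + \<bar>z + e * (c3 - z) - c3\<bar> < r / 2"
      if "0 < e" "e \<le> 1" for e
    proof -
      have "\<bar>u + e * (k - u) - k\<bar> = (1 - e) * \<bar>u - k\<bar>" for u k
      proof -
        have "u + e * (k - u) - k = (1 - e) * (u - k)" by (simp add: algebra_simps)
        then show ?thesis using that by (simp add: abs_mult)
      qed
      then have "\<bar>x + e * (c1 - x) - c1\<bar> + \<bar>y + e * (c2 - y) - c2\<bar> + \<bar>z + e * (c3 - z) - c3\<bar>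
        = (1 - e) * (\<bar>x - c1\<bar> + \<bar>y - c2\<bar> + \<bar>z - c3\<bar>)" by (simp add: distrib_left)
      also have "\<dots> \<le> (1 - e) * (r / 2)" using le that by (intro mult_left_mono) auto
      also have "\<dots> < r / 2" using that r by (simp add: field_simps)
      finally show ?thesis .
    qed
    define q where "q = (\<lambda>n. let e = inverse (real (Suc n)) in (x + e * (c1 - x), y + e * (c2 - y), z + e * (c3 - z)))"
    have "q n \<in> A" for n unfolding q_def Let_def by (intro ball *) (auto simp: field_simps)
    moreover have "q \<longlonglongrightarrow> p"
    proof -
      have "(\<lambda>n. k + inverse (real (Suc n)) * l) \<longlonglongrightarrow> k + 0 * l" for k l
        by (intro tendsto_intros LIMSEQ_inverse_real_of_nat)
      then show ?thesis unfolding q_def Let_def p by (intro tendsto_Pair) simp_all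
    qed
    ultimately show "p \<in> closure A" unfolding closure_sequential by blast
  qed
  ultimately show ?thesis unfolding T_octahedron_def A_def by blast
qed

end

theory Submission
  imports Defs
begin

text \<open>
  The game on the cell \<open>(i, j)\<close> is Nim with the four heaps \<open>p = i - 1\<close>, \<open>p' = m - i\<close>, \<open>q = j - 1\<close>,
  \<open>q' = m - j\<close>, so \<open>(i, j)\<close> is a P-position iff \<open>p \<oplus> p' \<oplus> q \<oplus> q' = 0\<close>; moreover \<open>p + p' = q + q' = m - 1\<close>.
  These two conditions together force \<open>p + p' = q + q'\<close> separately in every binary digit, which leaves six
  possibilities per digit. Scaled by \<open>2\<^sup>n\<close>, the centres of the small octahedra are the sums of \<open>2\<^sup>k d\<^sub>k\<close>,
  \<open>k < n\<close>, where \<open>d\<^sub>k\<close> is one of the six signed unit vectors, and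
  \<open>(p, p', q, q') \<mapsto> (p - q', p - q, 2\<^sup>n - 1 - (p + p'))\<close> matches the two digit systems. At height
  \<open>2\<^sup>n - m\<close> the section therefore consists of squares with horizontal and vertical diagonals centred at
  \<open>(p - q', p - q)\<close>, and rotating the pattern by \<open>45\<close> degrees gives exactly these.
\<close>

unbundle bit_operations_syntax

section \<open>Nim\<close>

text \<open>Bracketed in pairs, so that vanishing reads \<open>a XOR b = c XOR d\<close>.\<close>

definition nim_sum4 :: "nat \<Rightarrow> nat \<Rightarrow> nat \<Rightarrow> nat \<Rightarrow> nat" where
  "nim_sum4 a b c d = (a XOR b) XOR (c XOR d)"

text \<open>The mex property of the nim sum; applied to \<open>x = 0\<close> first, it yields the winning move in Nim.\<close>

lemma less_xor_cases:
  fixes x a b :: nat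
  assumes "x < a XOR b"
  shows "x XOR b < a \<or> x XOR a < b"
  using assms
proof (induction "x + a + b" arbitrary: x a b rule: less_induct)
  case less
  show ?case
  proof (cases "a + b = 0")
    case True
    then show ?thesis using less.prems by simp
  next
    case False
    define x' a' b' where h: "x' = x div 2" "a' = a div 2" "b' = b div 2"
    have lt: "x' + a' + b' < x + a + b" using False h by linarith
    have r: "a XOR b = of_bool (odd a \<noteq> odd b) + 2 * (a' XOR b')"
      "x XOR b = of_bool (odd x \<noteq> odd b) + 2 * (x' XOR b')"
      "x XOR a = of_bool (odd x \<noteq> odd a) + 2 * (x' XOR a')"
      using xor_rec[of a b] xor_rec[of x b] xor_rec[of x a] by (simp_all add: h)
    have d: "x = of_bool (odd x) + 2 * x'" "a = of_bool (odd a) + 2 * a'"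
      "b = of_bool (odd b) + 2 * b'"
      by (simp_all add: h mod_2_eq_odd [symmetric])
    have ob: "of_bool P \<le> (1::nat)" for P by simp
    show ?thesis
    proof (cases "x' < a' XOR b'")
      case True
      \<comment> \<open>A strict inequality between the halves survives whatever the last digits
        are.\<close>
      from less.hyps[OF lt True] show ?thesis
      proof
        assume "x' XOR b' < a'"
        then have "x XOR b < a" using r(2) d(2) ob[of "odd x \<noteq> odd b"] by linarith
        then show ?thesis ..
      next
        assume "x' XOR a' < b'"
        then have "x XOR a < b" using r(3) d(3) ob[of "odd x \<noteq> odd a"] by linarith
        then show ?thesis ..
      qed
    next
      case nl: False
      \<comment> \<open>The leading digits agree, so the last digit decides: it is 0 in
        \<open>x\<close> and 1 in \<open>a XOR b\<close>. Exactly one of \<open>a\<close> and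
        \<open>b\<close> is odd, and that one loses its final 1.\<close>
      then have eq: "x' = a' XOR b'" and par: "even x" "odd a \<noteq> odd b"
        using less.prems d(1) r(1) by (auto simp: of_bool_def split: if_splits)
      have e: "x' XOR b' = a'" "x' XOR a' = b'"
        by (simp_all add: eq xor.assoc) (metis xor.assoc xor.commute xor.right_neutral xor_self_eq)
      show ?thesis
      proof (cases "odd a")
        case True
        then have "x XOR b < a" using r(2) d(2) par e by simp
        then show ?thesis ..
      next
        case False
        then have "x XOR a < b" using r(3) d(3) par e by simp
        then show ?thesis ..
      qed
    qed
  qed
qed

lemma xor_right_cancel: "a XOR b = c XOR b \<longleftrightarrow> a = c" for a b c :: nat
  by (metis xor.assoc xor.right_neutral xor_self_eq)

lemma xor_left_cancel: "b XOR a = b XOR c \<longleftrightarrow> a = c" for a b c :: nat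
  using xor_right_cancel by (simp add: xor.commute)

lemma xor_eq_0_iff: "a XOR b = 0 \<longleftrightarrow> a = b" for a b :: nat
  using xor_right_cancel[of a b b] by simp

lemma xor_div_2: "(a XOR b) div 2 = (a div 2) XOR (b div 2)" for a b :: nat
  using xor_rec[of a b] by simp

text \<open>The mex property at 0 finds the pair with the larger nim sum. Applied again inside that
  pair, with the nim sum of the other pair as \<open>x\<close>, it finds the heap to reduce.\<close>

lemma nim_sum4_reduce:
  assumes "nim_sum4 a b c d \<noteq> 0"
  shows "(\<exists>x<a. nim_sum4 x b c d = 0) \<or> (\<exists>x<b. nim_sum4 a x c d = 0) \<or>
    (\<exists>x<c. nim_sum4 a b x d = 0) \<or> (\<exists>x<d. nim_sum4 a b c x = 0)"
proof -
  have "0 < (a XOR b) XOR (c XOR d)" using assms by (simp add: nim_sum4_def)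
  from less_xor_cases[OF this] have "c XOR d < a XOR b \<or> a XOR b < c XOR d" by simp
  then consider "(c XOR d) XOR b < a" | "(c XOR d) XOR a < b" | "(a XOR b) XOR d < c" | "(a XOR b) XOR c < d"
    using less_xor_cases by blast
  then show ?thesis
    by cases (auto simp: nim_sum4_def xor_eq_0_iff xor.assoc xor.commute xor.left_commute)
qed

lemma nim_sum4_cancel:
  "nim_sum4 a b c d = 0 \<Longrightarrow> nim_sum4 a' b c d = 0 \<Longrightarrow> a = a'"
  "nim_sum4 a b c d = 0 \<Longrightarrow> nim_sum4 a b' c d = 0 \<Longrightarrow> b = b'"
  "nim_sum4 a b c d = 0 \<Longrightarrow> nim_sum4 a b c' d = 0 \<Longrightarrow> c = c'"
  "nim_sum4 a b c d = 0 \<Longrightarrow> nim_sum4 a b c d' = 0 \<Longrightarrow> d = d'"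
  unfolding nim_sum4_def xor_eq_0_iff by (metis xor_left_cancel xor_right_cancel)+

text \<open>The last digit of the nim sum is the parity of the ordinary sum; the other digits form
  the nim sum of the halves.\<close>

lemma nim_sum4_eq_0_rec:
  "nim_sum4 a b c d = 0 \<longleftrightarrow>
    even (a + b + c + d) \<and> nim_sum4 (a div 2) (b div 2) (c div 2) (d div 2) = 0"
proof -
  have "x = y \<longleftrightarrow> (even x \<longleftrightarrow> even y) \<and> x div 2 = y div 2" for x y :: nat by presburger
  from this[of "a XOR b" "c XOR d"] show ?thesis
    unfolding nim_sum4_def xor_eq_0_iff xor_div_2 even_xor_iff by auto
qed

section \<open>The chocolate game\<close>

text \<open>The distances from the poisoned cell to the four sides are the Nim heaps.\<close>

definition rect :: "cell \<Rightarrow> nat \<Rightarrow> nat \<Rightarrow> nat \<Rightarrow> nat \<Rightarrow> bar" where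
  "rect p w e s n = {fst p - int w..fst p + int e} \<times> {snd p - int s..snd p + int n}"

lemma move_cases:
  assumes "move p R B"
  obtains k where "p \<in> B" "B = {c \<in> R. fst c \<le> k}" "{c \<in> R. k < fst c} \<noteq> {}"
    | k where "p \<in> B" "B = {c \<in> R. k < fst c}" "{c \<in> R. fst c \<le> k} \<noteq> {}"
    | k where "p \<in> B" "B = {c \<in> R. snd c \<le> k}" "{c \<in> R. k < snd c} \<noteq> {}"
    | k where "p \<in> B" "B = {c \<in> R. k < snd c}" "{c \<in> R. snd c \<le> k} \<noteq> {}"
proof -
  from assms obtain E where pB: "p \<in> B" and "breaks_into R B E \<or> breaks_into R E B"
    unfolding move_def by (elim conjE exE)
  from this(2) show thesis
    unfolding breaks_into_def
  proof (elim disjE conjE exE)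
    fix k assume "E \<noteq> {}" "B = {c \<in> R. fst c \<le> k}" "E = {c \<in> R. k < fst c}"
    then show thesis by (intro that(1)[OF pB, of k]) simp_all
  next
    fix k assume "E \<noteq> {}" "B = {c \<in> R. snd c \<le> k}" "E = {c \<in> R. k < snd c}"
    then show thesis by (intro that(3)[OF pB, of k]) simp_all
  next
    fix k assume "E \<noteq> {}" "E = {c \<in> R. fst c \<le> k}" "B = {c \<in> R. k < fst c}"
    then show thesis by (intro that(2)[OF pB, of k]) simp_all
  next
    fix k assume "E \<noteq> {}" "E = {c \<in> R. snd c \<le> k}" "B = {c \<in> R. k < snd c}"
    then show thesis by (intro that(4)[OF pB, of k]) simp_all
  qed
qed

lemma moveI:
  assumes "p \<in> B" "d \<in> E"
    and "B = {c \<in> R. fst c \<le> k} \<and> E = {c \<in> R. k < fst c} \<or>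
      B = {c \<in> R. snd c \<le> k} \<and> E = {c \<in> R. k < snd c} \<or>
      E = {c \<in> R. fst c \<le> k} \<and> B = {c \<in> R. k < fst c} \<or>
      E = {c \<in> R. snd c \<le> k} \<and> B = {c \<in> R. k < snd c}"
  shows "move p R B"
proof -
  have ne: "B \<noteq> {}" "E \<noteq> {}" using assms(1,2) by blast+
  consider "B = {c \<in> R. fst c \<le> k} \<and> E = {c \<in> R. k < fst c} \<or>
      B = {c \<in> R. snd c \<le> k} \<and> E = {c \<in> R. k < snd c}"
    | "E = {c \<in> R. fst c \<le> k} \<and> B = {c \<in> R. k < fst c} \<or>
      E = {c \<in> R. snd c \<le> k} \<and> B = {c \<in> R. k < snd c}"
    using assms(3) by argo
  then show ?thesis
  proof cases
    case 1
    then have "breaks_into R B E" unfolding breaks_into_def by (intro conjI ne exI[of _ k])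
    then show ?thesis unfolding move_def by (intro conjI assms(1) exI[of _ E] disjI1)
  next
    case 2
    then have "breaks_into R E B" unfolding breaks_into_def by (intro conjI ne exI[of _ k])
    then show ?thesis unfolding move_def by (intro conjI assms(1) exI[of _ E] disjI2)
  qed
qed

text \<open>This identifies the game with Nim: a break pulls exactly one side closer to the poisoned
  cell and leaves the other three in place.\<close>

lemma move_rect_iff:
  "move p (rect p w e s n) B \<longleftrightarrow>
    (\<exists>x<w. B = rect p x e s n) \<or> (\<exists>x<e. B = rect p w x s n) \<or>
    (\<exists>x<s. B = rect p w e x n) \<or> (\<exists>x<n. B = rect p w e s x)" (is "?L \<longleftrightarrow> ?R")
proof
  obtain i j where p: "p = (i, j)" by (cases p)
  let ?S = "rect p w e s n"
  {
    assume ?L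
    then show ?R
    proof (cases rule: move_cases)
      case (1 k)
      \<comment> \<open>The lower part keeps line \<open>k\<close>, the upper part starts at
        \<open>k + 1\<close>; hence the extra \<open>- 1\<close> in the distances of the second and
        fourth cases. Strictness holds because the eaten part is nonempty, and \<open>nat\<close>
        cuts nothing off because \<open>p \<in> B\<close>.\<close>
      then have "nat (k - i) < e" "B = rect p w (nat (k - i)) s n"
        by (auto simp: rect_def p)
      then show ?thesis by blast
    next
      case (2 k)
      then have "nat (i - k - 1) < w" "B = rect p (nat (i - k - 1)) e s n"
        by (auto simp: rect_def p)
      then show ?thesis by blast
    next
      case (3 k)
      then have "nat (k - j) < n" "B = rect p w e s (nat (k - j))"
        by (auto simp: rect_def p)
      then show ?thesis by blast
    next
      case (4 k)
      then have "nat (j - k - 1) < s" "B = rect p w e (nat (j - k - 1)) n"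
        by (auto simp: rect_def p)
      then show ?thesis by blast
    qed
  }
  assume ?R
  then show ?L
  proof (elim disjE exE conjE)
    fix x assume x: "x < w" "B = rect p x e s n"
    let ?k = "i - int x - 1"
    \<comment> \<open>The outermost cell in line with the poisoned one shows that the eaten part is
      nonempty.\<close>
    have "p \<in> B" "(i - int w, j) \<in> {c \<in> ?S. fst c \<le> ?k}" "B = {c \<in> ?S. ?k < fst c}"
      using x by (auto simp: rect_def p)
    note * = this
    show ?thesis by (rule moveI[OF *(1,2), where k = ?k]) (use *(3) in simp)
  next
    fix x assume x: "x < e" "B = rect p w x s n"
    let ?k = "i + int x"
    have "p \<in> B" "(i + int e, j) \<in> {c \<in> ?S. ?k < fst c}" "B = {c \<in> ?S. fst c \<le> ?k}"
      using x by (auto simp: rect_def p)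
    note * = this
    show ?thesis by (rule moveI[OF *(1,2), where k = ?k]) (use *(3) in simp)
  next
    fix x assume x: "x < s" "B = rect p w e x n"
    let ?k = "j - int x - 1"
    have "p \<in> B" "(i, j - int s) \<in> {c \<in> ?S. snd c \<le> ?k}" "B = {c \<in> ?S. ?k < snd c}"
      using x by (auto simp: rect_def p)
    note * = this
    show ?thesis by (rule moveI[OF *(1,2), where k = ?k]) (use *(3) in simp)
  next
    fix x assume x: "x < n" "B = rect p w e s x"
    let ?k = "j + int x"
    have "p \<in> B" "(i, j + int n) \<in> {c \<in> ?S. ?k < snd c}" "B = {c \<in> ?S. snd c \<le> ?k}"
      using x by (auto simp: rect_def p)
    note * = this
    show ?thesis by (rule moveI[OF *(1,2), where k = ?k]) (use *(3) in simp)
  qed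
qed

lemma move_from_nonzero:
  assumes "nim_sum4 w e s n \<noteq> 0"
  obtains w' e' s' n' where "move p (rect p w e s n) (rect p w' e' s' n')" "nim_sum4 w' e' s' n' = 0"
proof -
  have "move p (rect p w e s n) (rect p x e s n)" if "x < w" for x
    unfolding move_rect_iff using that by blast
  moreover have "move p (rect p w e s n) (rect p w x s n)" if "x < e" for x
    unfolding move_rect_iff using that by blast
  moreover have "move p (rect p w e s n) (rect p w e x n)" if "x < s" for x
    unfolding move_rect_iff using that by blast
  moreover have "move p (rect p w e s n) (rect p w e s x)" if "x < n" for x
    unfolding move_rect_iff using that by blast
  ultimately show thesis
    using nim_sum4_reduce[OF assms] that by (elim disjE exE conjE) metis+
qed

lemma move_from_zero:
  assumes "nim_sum4 w e s n = 0" "move p (rect p w e s n) B"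
  obtains w' e' s' n' where "B = rect p w' e' s' n'" "nim_sum4 w' e' s' n' \<noteq> 0"
  using assms(2) unfolding move_rect_iff
proof (elim disjE exE conjE)
  fix x assume "x < w" "B = rect p x e s n"
  then show thesis using nim_sum4_cancel(1)[OF assms(1), of x] by (intro that) auto
next
  fix x assume "x < e" "B = rect p w x s n"
  then show thesis using nim_sum4_cancel(2)[OF assms(1), of x] by (intro that) auto
next
  fix x assume "x < s" "B = rect p w e x n"
  then show thesis using nim_sum4_cancel(3)[OF assms(1), of x] by (intro that) auto
next
  fix x assume "x < n" "B = rect p w e s x"
  then show thesis using nim_sum4_cancel(4)[OF assms(1), of x] by (intro that) auto
qed

lemma breaks_into_psubset:
  assumes "breaks_into B X Y"
  shows "X \<subset> B" "Y \<subset> B"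
proof -
  have "X \<union> Y = B" "X \<inter> Y = {}" "X \<noteq> {}" "Y \<noteq> {}"
    using assms unfolding breaks_into_def by auto
  then show "X \<subset> B" "Y \<subset> B" by blast+
qed

lemma move_psubset:
  assumes "move p B B'"
  shows "B' \<subset> B"
proof -
  from assms obtain E where "breaks_into B B' E \<or> breaks_into B E B'"
    unfolding move_def by (elim conjE exE)
  then show ?thesis by (elim disjE) (erule breaks_into_psubset)+
qed

text \<open>From a nonzero bar the first player could move to a zero one. Any reply is then nonzero
  again, against the induction hypothesis for that reply.\<close>

lemma second_player_wins_imp_zero:
  assumes "second_player_wins p \<sigma> (rect p w e s n)"
  shows "nim_sum4 w e s n = 0"
  using assms
proof (induction "rect p w e s n" arbitrary: w e s n rule: second_player_wins.induct)
  case (1 w e s n)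
  show ?case
  proof (rule ccontr)
    assume "nim_sum4 w e s n \<noteq> 0"
    then obtain w1 e1 s1 n1 where m: "move p (rect p w e s n) (rect p w1 e1 s1 n1)"
      and z: "nim_sum4 w1 e1 s1 n1 = 0" by (rule move_from_nonzero)
    from 1[OF m] have m': "move p (rect p w1 e1 s1 n1) (\<sigma> (rect p w1 e1 s1 n1))" by blast
    from move_from_zero[OF z m'] obtain w2 e2 s2 n2
      where "\<sigma> (rect p w1 e1 s1 n1) = rect p w2 e2 s2 n2" "nim_sum4 w2 e2 s2 n2 \<noteq> 0" by blast
    then show False using 1[OF m] by metis
  qed
qed

lemma zero_imp_second_player_wins:
  "\<exists>\<sigma>. \<forall>w e s n. nim_sum4 w e s n = 0 \<longrightarrow> second_player_wins p \<sigma> (rect p w e s n)"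
proof -
  let ?Z = "\<lambda>B. \<exists>w e s n. B = rect p w e s n \<and> nim_sum4 w e s n = 0"
  \<comment> \<open>One strategy for all bars around \<open>p\<close>: pass on some zero bar. Such a
    reply exists at every nonzero bar, and a move from a zero bar always leads to one; elsewhere the
    value is arbitrary.\<close>
  define \<sigma> where "\<sigma> = (\<lambda>B. SOME B'. move p B B' \<and> ?Z B')"
  have \<sigma>: "move p (rect p w e s n) (\<sigma> (rect p w e s n)) \<and> ?Z (\<sigma> (rect p w e s n))"
    if "nim_sum4 w e s n \<noteq> 0" for w e s n
    unfolding \<sigma>_def using move_from_nonzero[OF that] by (rule someI2_ex) blast+
  have "second_player_wins p \<sigma> (rect p w e s n)" if "nim_sum4 w e s n = 0" for w e s n
    using that
  proof (induction "card (rect p w e s n)" arbitrary: w e s n rule: less_induct)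
    case less
    show ?case
    proof (rule second_player_wins.intros)
      fix B assume mB: "move p (rect p w e s n) B"
      then obtain w' e' s' n' where B: "B = rect p w' e' s' n'" "nim_sum4 w' e' s' n' \<noteq> 0"
        using move_from_zero[OF less.prems] by blast
      from \<sigma>[OF B(2)] have m: "move p B (\<sigma> B)" "?Z (\<sigma> B)" by (simp_all add: B)
      have "card (\<sigma> B) < card (rect p w e s n)"
        using move_psubset[OF mB] move_psubset[OF m(1)]
        by (intro psubset_card_mono) (auto simp: rect_def)
      then show "move p B (\<sigma> B) \<and> second_player_wins p \<sigma> (\<sigma> B)"
        using m less.hyps by auto
    qed
  qed
  then show ?thesis by blast
qed

lemma P_positions_iff:
  "(i, j) \<in> P_positions m \<longleftrightarrow> 1 \<le> i \<and> i \<le> m \<and> 1 \<le> j \<and> j \<le> m \<and>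
    nim_sum4 (nat (i - 1)) (nat (m - i)) (nat (j - 1)) (nat (m - j)) = 0"
proof (cases "(i, j) \<in> bar_square m")
  case True
  then have "bar_square m = rect (i, j) (nat (i - 1)) (nat (m - i)) (nat (j - 1)) (nat (m - j))"
    by (auto simp: bar_square_def rect_def)
  then have "(\<exists>\<sigma>. second_player_wins (i, j) \<sigma> (bar_square m)) \<longleftrightarrow>
      nim_sum4 (nat (i - 1)) (nat (m - i)) (nat (j - 1)) (nat (m - j)) = 0"
    using second_player_wins_imp_zero zero_imp_second_player_wins[of "(i, j)"]
    by (simp only:) blast
  with True show ?thesis by (simp add: P_positions_def) (simp add: bar_square_def)
qed (auto simp: P_positions_def bar_square_def)

section \<open>The octahedra of the Sierpinski octahedron\<close>

text \<open>Scaling by \<open>2^n\<close> keeps everything integral: the shift by half a radius,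
  \<open>1 / 2^(n+1)\<close>, becomes a signed unit vector at the next scale.\<close>

primrec centres :: "nat \<Rightarrow> (int \<times> int \<times> int) set" where
  "centres 0 = {(0, 0, 0)}"
| "centres (Suc n) = {(2 * a + u, 2 * b + v, 2 * c + w) | a b c u v w.
     (a, b, c) \<in> centres n \<and> \<bar>u\<bar> + \<bar>v\<bar> + \<bar>w\<bar> = 1}"

lemma abs_sum_eq_1_cases:
  fixes u v w :: int
  shows "\<bar>u\<bar> + \<bar>v\<bar> + \<bar>w\<bar> = 1 \<longleftrightarrow>
    (u, v, w) \<in> {(1, 0, 0), (-1, 0, 0), (0, 1, 0), (0, -1, 0), (0, 0, 1), (0, 0, -1)}"
  unfolding insert_iff empty_iff prod.inject by presburger

definition scaled_octahedron :: "nat \<Rightarrow> int \<times> int \<times> int \<Rightarrow> point3 \<times> real" where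
  "scaled_octahedron n = (\<lambda>(a, b, c). ((of_int a / 2 ^ n, of_int b / 2 ^ n, of_int c / 2 ^ n), 1 / 2 ^ n))"

lemma remaining_octahedra_scaled:
  "(case scaled_octahedron n (a, b, c) of (p, r) \<Rightarrow> remaining_octahedra p r) =
    {scaled_octahedron (Suc n) (2 * a + u, 2 * b + v, 2 * c + w) | u v w. \<bar>u\<bar> + \<bar>v\<bar> + \<bar>w\<bar> = 1}"
  (is "?L = ?R")
proof -
  have gen: "{f t e | t e. t \<in> {-1, 1} \<and> e \<in> (Basis :: point3 set)} =
      {f 1 (1,0,0), f (-1) (1,0,0), f 1 (0,1,0), f (-1) (0,1,0), f 1 (0,0,1), f (-1) (0,0,1)}"
    for f :: "real \<Rightarrow> point3 \<Rightarrow> point3 \<times> real"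
    unfolding Basis_point3 by blast
  have image_triples: "{g u v w | u v w. (u, v, w) \<in> S} = (\<lambda>(u, v, w). g u v w) ` S"
    for g :: "int \<Rightarrow> int \<Rightarrow> int \<Rightarrow> point3 \<times> real" and S
    by (simp add: image_def Bex_def conj_commute)
  have "?R = (\<lambda>(u, v, w). scaled_octahedron (Suc n) (2 * a + u, 2 * b + v, 2 * c + w)) `
      {(1, 0, 0), (-1, 0, 0), (0, 1, 0), (0, -1, 0), (0, 0, 1), (0, 0, -1)}"
    unfolding abs_sum_eq_1_cases image_triples ..
  also have "\<dots> = ?L"
    unfolding scaled_octahedron_def remaining_octahedra_def prod.case gen
    by (simp add: midpoint_def field_simps)
  finally show ?thesis ..
qed

lemma sierpinski_octahedra_eq: "sierpinski_octahedra n = scaled_octahedron n ` centres n"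
proof (induction n)
  case 0
  show ?case by (simp add: scaled_octahedron_def zero_prod_def)
next
  case (Suc n)
  have "sierpinski_octahedra (Suc n) =
      (\<Union>(a, b, c)\<in>centres n. case scaled_octahedron n (a, b, c) of (p, r) \<Rightarrow> remaining_octahedra p r)"
    unfolding sierpinski_octahedra.simps Suc by auto
  also have "\<dots> = scaled_octahedron (Suc n) ` centres (Suc n)"
    unfolding remaining_octahedra_scaled by auto blast
  finally show ?case .
qed

text \<open>Stage \<open>Suc k\<close> applies \<open>T\<close> to the octahedra of stage
  \<open>k\<close>; since their radii are positive, \<open>T_octahedron_eq\<close> replaces each
  closure by the six smaller octahedra.\<close>

lemma sierpinski_eq: "sierpinski n = (\<Union>(p, r)\<in>sierpinski_octahedra n. octahedron p r)"
proof (cases n)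
  case (Suc k)
  have pos: "r > 0" if "(p, r) \<in> sierpinski_octahedra k" for p r
    using that by (auto simp: sierpinski_octahedra_eq scaled_octahedron_def)
  have "(\<Union>(p, r)\<in>sierpinski_octahedra k. T_octahedron p r) =
      (\<Union>(p, r)\<in>sierpinski_octahedra k. \<Union>(p', r')\<in>remaining_octahedra p r. octahedron p' r')"
    by (intro SUP_cong refl) (auto simp only: T_octahedron_eq[OF pos] split: prod.split)
  then show ?thesis unfolding Suc by auto
qed simp

section \<open>Points and horizontal sections of the Sierpinski octahedron\<close>

lemma mem_sierpinski_iff:
  "(x, y, z) \<in> sierpinski n \<longleftrightarrow>
    (\<exists>a b c. (a, b, c) \<in> centres n \<and> \<bar>2 ^ n * x - of_int a\<bar> + \<bar>2 ^ n * y - of_int b\<bar> + \<bar>2 ^ n * z - of_int c\<bar> \<le> 1)"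
proof -
  have scale: "\<bar>x - of_int a / 2 ^ n\<bar> + \<bar>y - of_int b / 2 ^ n\<bar> + \<bar>z - of_int c / 2 ^ n\<bar> \<le> 1 / 2 ^ n \<longleftrightarrow>
      \<bar>2 ^ n * x - of_int a\<bar> + \<bar>2 ^ n * y - of_int b\<bar> + \<bar>2 ^ n * z - of_int c\<bar> \<le> 1" for a b c
  proof -
    have "\<bar>t - of_int k / 2 ^ n\<bar> = \<bar>2 ^ n * t - of_int k\<bar> / 2 ^ n" for t :: real and k
    proof -
      have "t - of_int k / 2 ^ n = (2 ^ n * t - of_int k) / 2 ^ n" by (simp add: field_simps)
      then show ?thesis by simp
    qed
    then show ?thesis by (simp add: add_divide_distrib [symmetric] divide_le_cancel)
  qed
  show ?thesis
    unfolding sierpinski_eq sierpinski_octahedra_eq scaled_octahedron_def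
    by (force simp: octahedron_eq scale)
qed

text \<open>A vertex of one of the octahedra at height \<open>h\<close> is an equatorial vertex of another one, unless it is an
  apex of the whole figure. So the section at height \<open>h\<close> is a union of squares, without isolated points.\<close>

lemma centres_apex:
  assumes "(a, b, c) \<in> centres n" "\<bar>c - h\<bar> = 1" "\<bar>h\<bar> < 2 ^ n"
  shows "\<exists>a' b'. (a', b', h) \<in> centres n \<and> \<bar>a - a'\<bar> + \<bar>b - b'\<bar> = 1"
  using assms
proof (induction n arbitrary: a b c h)
  case (Suc n)
  then obtain A B C u v w where abc: "a = 2 * A + u" "b = 2 * B + v" "c = 2 * C + w"
    and mem: "(A, B, C) \<in> centres n" and uvw: "\<bar>u\<bar> + \<bar>v\<bar> + \<bar>w\<bar> = 1" by auto
  have step: "(2 * A' + u', 2 * B' + v', 2 * C' + w') \<in> centres (Suc n)"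
    if "(A', B', C') \<in> centres n" "\<bar>u'\<bar> + \<bar>v'\<bar> + \<bar>w'\<bar> = 1" for A' B' C' u' v' w'
    using that unfolding centres.simps mem_Collect_eq by blast
  \<comment> \<open>Relative to the parent centred at \<open>(A, B, C)\<close>, the height
    \<open>h\<close> is that of a polar child (\<open>2 * C + 1\<close> or
    \<open>2 * C - 1\<close>), of the equatorial children (\<open>2 * C\<close>), or of an apex of
    the parent (\<open>2 * (C + w)\<close>). Only the last case needs the induction
    hypothesis.\<close>
  consider "w = 0" | "w = c - h" "w \<noteq> 0" | "w = h - c" "w \<noteq> 0" using uvw Suc.prems(2) by linarith
  then show ?case
  proof cases
    case 1
    then have "(2 * A, 2 * B, h) \<in> centres (Suc n)"
      using step[OF mem, of 0 0 "h - c"] Suc.prems(2) by (simp add: abc)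
    then show ?thesis using uvw 1 by - (rule exI[of _ "2 * A"], rule exI[of _ "2 * B"], simp add: abc del: centres.simps)
  next
    case 2
    then have uv: "u = 0" "v = 0" using uvw Suc.prems(2) by linarith+
    from 2 have "(2 * A + 1, 2 * B, h) \<in> centres (Suc n)"
      using step[OF mem, of 1 0 0] by (simp add: abc)
    then show ?thesis by - (rule exI[of _ "2 * A + 1"], rule exI[of _ "2 * B"], simp add: abc uv del: centres.simps)
  next
    case 3
    then have w: "\<bar>w\<bar> = 1" using Suc.prems(2) by linarith
    then have uv: "u = 0" "v = 0" using uvw by linarith+
    have h: "h = 2 * (C + w)" using 3(1) abc(3) by (simp add: algebra_simps)
    have "\<bar>C - (C + w)\<bar> = 1" "\<bar>C + w\<bar> < 2 ^ n" using w Suc.prems(3) h by (auto simp: abs_mult)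
    from Suc.IH[OF mem this] obtain A' B' where A': "(A', B', C + w) \<in> centres n"
      and d: "\<bar>A - A'\<bar> + \<bar>B - B'\<bar> = 1" by blast
    \<comment> \<open>The neighbour of the parent has an equatorial vertex at the parent's apex;
      this is its child at that vertex.\<close>
    have "(A + A', B + B', h) \<in> centres (Suc n)"
      using step[OF A', of "A - A'" "B - B'" 0] d by (simp add: h algebra_simps del: centres.simps)
    then show ?thesis using d uv by - (rule exI[of _ "A + A'"], rule exI[of _ "B + B'"], simp add: abc del: centres.simps)
  qed
qed simp

lemma mem_horizontal_section_iff:
  assumes "0 < m" "m \<le> 2 ^ n"
  shows "(x, y) \<in> horizontal_section n m \<longleftrightarrow>
    (\<exists>a b. (a, b, 2 ^ n - m) \<in> centres n \<and> \<bar>2 ^ n * x - of_int a\<bar> + \<bar>2 ^ n * y - of_int b\<bar> \<le> 1)"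
    (is "_ \<longleftrightarrow> ?R")
proof
  let ?h = "2 ^ n - m"
  have z: "2 ^ n * (1 - of_int m / 2 ^ n) - of_int c = (of_int (?h - c) :: real)" for c
    by (simp add: field_simps)
  {
    assume "(x, y) \<in> horizontal_section n m"
    then obtain a b c where mem: "(a, b, c) \<in> centres n"
      and le: "\<bar>2 ^ n * x - of_int a\<bar> + \<bar>2 ^ n * y - of_int b\<bar> + of_int \<bar>?h - c\<bar> \<le> 1"
      unfolding horizontal_section_def mem_sierpinski_iff mem_Collect_eq prod.case z of_int_abs by blast
    have "(of_int \<bar>?h - c\<bar> :: real) \<le> of_int 1" using le by linarith
    then have "\<bar>?h - c\<bar> \<le> 1" unfolding of_int_le_iff .
    then consider "c = ?h" | "\<bar>c - ?h\<bar> = 1" by linarith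
    then show ?R
    proof cases
      case 1
      then show ?thesis using mem le by auto
    next
      case 2
      \<comment> \<open>A vertical distance of 1 uses up the whole radius, so the point is an apex.
        As \<open>0 < m\<close> and \<open>m \<le> 2 ^ n\<close>, its height lies strictly between
        those of the two poles, so \<open>centres_apex\<close> provides a square that contains
        it.\<close>
      with le have "2 ^ n * x = of_int a" "2 ^ n * y = of_int b"
        by (simp_all add: abs_minus_commute)
      moreover obtain a' b' where "(a', b', ?h) \<in> centres n" "\<bar>a - a'\<bar> + \<bar>b - b'\<bar> = 1"
        using centres_apex[OF mem 2] assms by auto
      moreover from this(2) have "of_int (\<bar>a - a'\<bar> + \<bar>b - b'\<bar>) = (1 :: real)" by simp
      ultimately show ?thesis by (intro exI conjI) auto
    qed
  }
  assume ?R
  then obtain a b where "(a, b, ?h) \<in> centres n" "\<bar>2 ^ n * x - of_int a\<bar> + \<bar>2 ^ n * y - of_int b\<bar> \<le> 1" by blast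
  then show "(x, y) \<in> horizontal_section n m"
    unfolding horizontal_section_def mem_sierpinski_iff mem_Collect_eq prod.case z
    by (intro exI conjI) auto
qed

section \<open>Matching binary digits of heaps and centres\<close>

text \<open>Both sides obey one binary recursion. Appending last digits \<open>s, s', t, t'\<close>
  with \<open>s + s' = t + t'\<close> to the heaps doubles \<open>(a, b, c)\<close> and adds
  \<open>(s - t', s - t, 1 - (s + s'))\<close>; the six admissible digit quadruples yield the six
  signed unit vectors.\<close>

lemma centres_iff:
  "(a, b, c) \<in> centres n \<longleftrightarrow>
    (\<exists>p p' q q'. p < 2 ^ n \<and> p' < 2 ^ n \<and> q < 2 ^ n \<and> q' < 2 ^ n \<and>
      nim_sum4 p p' q q' = 0 \<and> p + p' = q + q' \<and>
      a = int p - int q' \<and> b = int p - int q \<and> c = 2 ^ n - 1 - int (p + p'))"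
proof (induction n arbitrary: a b c)
  case 0
  show ?case by (auto simp: nim_sum4_def)
next
  case (Suc n)
  show ?case (is "_ \<longleftrightarrow> ?R")
  proof
    assume "(a, b, c) \<in> centres (Suc n)"
    then obtain A B C u v w where abc: "a = 2 * A + u" "b = 2 * B + v" "c = 2 * C + w"
      and mem: "(A, B, C) \<in> centres n" and uvw: "\<bar>u\<bar> + \<bar>v\<bar> + \<bar>w\<bar> = 1" by auto
    from mem obtain p p' q q' where lt: "p < 2 ^ n" "p' < 2 ^ n" "q < 2 ^ n" "q' < 2 ^ n"
      and eq: "nim_sum4 p p' q q' = 0" "p + p' = q + q'"
        "A = int p - int q'" "B = int p - int q" "C = 2 ^ n - 1 - int (p + p')"
      unfolding Suc by blast
    have witness: ?R if "s \<le> 1" "s' \<le> 1" "t \<le> 1" "t' \<le> 1" "s + s' = t + t'"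
      "u = int s - int t'" "v = int s - int t" "w = 1 - int (s + s')" for s s' t t'
    proof (intro exI conjI)
      show "nim_sum4 (2 * p + s) (2 * p' + s') (2 * q + t) (2 * q' + t') = 0"
      proof -
        have "(2 * p + s) div 2 = p" "(2 * p' + s') div 2 = p'" "(2 * q + t) div 2 = q" "(2 * q' + t') div 2 = q'"
          using that by auto
        moreover have "(2 * p + s) + (2 * p' + s') + (2 * q + t) + (2 * q' + t') = 2 * (p + p' + q + q' + (t + t'))"
          using that by simp
        ultimately show ?thesis
          using eq(1) nim_sum4_eq_0_rec[of "2 * p + s" "2 * p' + s'" "2 * q + t" "2 * q' + t'"]
          by (simp only: dvd_triv_left simp_thms)
      qed
    qed (use that lt eq in \<open>auto simp: abc\<close>)
    from uvw consider "u = 1" "v = 0" "w = 0" | "u = -1" "v = 0" "w = 0" | "u = 0" "v = 1" "w = 0"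
      | "u = 0" "v = -1" "w = 0" | "u = 0" "v = 0" "w = 1" | "u = 0" "v = 0" "w = -1"
      unfolding abs_sum_eq_1_cases by auto
    then show ?R
    proof cases
      case 1 show ?thesis by (rule witness[of 1 0 1 0]) (simp_all add: 1)
    next
      case 2 show ?thesis by (rule witness[of 0 1 0 1]) (simp_all add: 2)
    next
      case 3 show ?thesis by (rule witness[of 1 0 0 1]) (simp_all add: 3)
    next
      case 4 show ?thesis by (rule witness[of 0 1 1 0]) (simp_all add: 4)
    next
      case 5 show ?thesis by (rule witness[of 0 0 0 0]) (simp_all add: 5)
    next
      case 6 show ?thesis by (rule witness[of 1 1 1 1]) (simp_all add: 6)
    qed
  next
    assume ?R
    then obtain p p' q q' where lt: "p < 2 ^ Suc n" "p' < 2 ^ Suc n" "q < 2 ^ Suc n" "q' < 2 ^ Suc n"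
      and z: "nim_sum4 p p' q q' = 0" and sum: "p + p' = q + q'"
      and abc: "a = int p - int q'" "b = int p - int q" "c = 2 ^ Suc n - 1 - int (p + p')" by blast
    define P P' Q Q' where D: "P = p div 2" "P' = p' div 2" "Q = q div 2" "Q' = q' div 2"
    define s s' t t' where d: "s = p mod 2" "s' = p' mod 2" "t = q mod 2" "t' = q' mod 2"
    have dec: "p = 2 * P + s" "p' = 2 * P' + s'" "q = 2 * Q + t" "q' = 2 * Q' + t'"
      by (simp_all add: D d)
    have bits: "s \<le> 1" "s' \<le> 1" "t \<le> 1" "t' \<le> 1" by (simp_all add: d)
    have Z: "nim_sum4 P P' Q Q' = 0" and "even (p + p' + q + q')"
      using z nim_sum4_eq_0_rec[of p p' q q'] by (simp_all add: D)
    then have par: "even (s + s' + t + t')" "even (P + P' + Q + Q')"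
      using nim_sum4_eq_0_rec[of P P' Q Q'] by (simp_all add: dec)
    \<comment> \<open>Why the digits balance separately: the digit sums are at most 2, so
      \<open>P + P'\<close> and \<open>Q + Q'\<close> differ by at most 1, while the nim sum
      condition on the next digit makes their difference even.\<close>
    have halves: "X = Y" if "2 * X + S = 2 * Y + T" "S \<le> 2" "T \<le> 2" "even (X + Y)" for X Y S T :: nat
      using that by presburger
    have SUM: "P + P' = Q + Q'"
      by (rule halves[where S = "s + s'" and T = "t + t'"])
         (use sum bits par(2) in \<open>simp_all add: dec add.assoc\<close>)
    then have sum': "s + s' = t + t'" using sum unfolding dec by linarith
    have "(int P - int Q', int P - int Q, 2 ^ n - 1 - int (P + P')) \<in> centres n"
      unfolding Suc using lt Z SUM
      by - (rule exI[of _ P], rule exI[of _ P'], rule exI[of _ Q], rule exI[of _ Q'], auto simp: D)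
    moreover have "\<bar>int s - int t'\<bar> + \<bar>int s - int t\<bar> + \<bar>1 - int (s + s')\<bar> = 1"
      using bits sum' by (auto simp: le_Suc_eq)
    ultimately show "(a, b, c) \<in> centres (Suc n)"
      unfolding centres.simps mem_Collect_eq by (intro exI conjI) (auto simp: abc dec)
  qed
qed

text \<open>Under \<open>p = i - 1\<close>, \<open>p' = m - i\<close>, \<open>q = j - 1\<close>,
  \<open>q' = m - j\<close>, fixing the height at \<open>2^n - m\<close> amounts to
  \<open>p + p' + 1 = m\<close>, the side of the bar.\<close>

lemma centres_section_iff:
  assumes "0 < m" "m \<le> 2 ^ n"
  shows "(a, b, 2 ^ n - m) \<in> centres n \<longleftrightarrow>
    (\<exists>i j. (i, j) \<in> P_positions m \<and> a = i + j - 1 - m \<and> b = i - j)"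
proof
  assume "(a, b, 2 ^ n - m) \<in> centres n"
  then obtain p p' q q' where *: "nim_sum4 p p' q q' = 0" "p + p' = q + q'"
    "a = int p - int q'" "b = int p - int q" "m = int (p + p') + 1"
    unfolding centres_iff by force
  then have "m - (int p + 1) = int p'" "m - (int q + 1) = int q'" by linarith+
  moreover from this have "int p + 1 \<le> m" "int q + 1 \<le> m" by linarith+
  ultimately have "(int p + 1, int q + 1) \<in> P_positions m"
    unfolding P_positions_iff using *(1) by (simp only: nat_int add_diff_cancel_right') simp
  moreover have "a = (int p + 1) + (int q + 1) - 1 - m" "b = (int p + 1) - (int q + 1)"
    using * by linarith+
  ultimately show "\<exists>i j. (i, j) \<in> P_positions m \<and> a = i + j - 1 - m \<and> b = i - j" by blast
next
  assume "\<exists>i j. (i, j) \<in> P_positions m \<and> a = i + j - 1 - m \<and> b = i - j"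
  then obtain i j where ij: "1 \<le> i" "i \<le> m" "1 \<le> j" "j \<le> m" "a = i + j - 1 - m" "b = i - j"
    "nim_sum4 (nat (i - 1)) (nat (m - i)) (nat (j - 1)) (nat (m - j)) = 0"
    unfolding P_positions_iff by blast
  define p p' q q' where d: "p = nat (i - 1)" "p' = nat (m - i)" "q = nat (j - 1)" "q' = nat (m - j)"
  have int: "int p = i - 1" "int p' = m - i" "int q = j - 1" "int q' = m - j"
    using ij by (simp_all add: d)
  \<comment> \<open>The heaps are at most \<open>m - 1\<close>, so \<open>m \<le> 2 ^ n\<close>
    makes them fit into \<open>n\<close> binary digits.\<close>
  have "int p < 2 ^ n" "int p' < 2 ^ n" "int q < 2 ^ n" "int q' < 2 ^ n"
    using ij(1-4) int assms by linarith+
  then have "p < 2 ^ n" "p' < 2 ^ n" "q < 2 ^ n" "q' < 2 ^ n" by simp_all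
  moreover have "nim_sum4 p p' q q' = 0" using ij(7) by (simp add: d)
  moreover have "p + p' = q + q'" "a = int p - int q'" "b = int p - int q"
    "2 ^ n - m = 2 ^ n - 1 - int (p + p')"
    using int ij(5,6) by linarith+
  ultimately show "(a, b, 2 ^ n - m) \<in> centres n" unfolding centres_iff by blast
qed

section \<open>The similarity between pattern and section\<close>

text \<open>The sum of the two absolute values is twice the larger of \<open>\<bar>u\<bar>\<close>
  and \<open>\<bar>v\<bar>\<close>.\<close>

lemma diamond_square_iff:
  fixes u v :: real
  shows "\<bar>u + v\<bar> + \<bar>u - v\<bar> \<le> 1 \<longleftrightarrow> \<bar>u\<bar> \<le> 1 / 2 \<and> \<bar>v\<bar> \<le> 1 / 2"
  by linarith

text \<open>Describes cells as maximum-norm balls about their centres, ready for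
  \<open>diamond_square_iff\<close>.\<close>

lemma mem_game_pattern_iff:
  "(x, y) \<in> game_pattern m \<longleftrightarrow> (\<exists>i j. (i, j) \<in> P_positions m \<and>
    \<bar>x - (of_int i - 1 / 2)\<bar> \<le> 1 / 2 \<and> \<bar>y - (of_int j - 1 / 2)\<bar> \<le> 1 / 2)"
proof -
  have "(\<exists>t. x = of_int i - t \<and> 0 \<le> t \<and> t \<le> 1) \<longleftrightarrow> \<bar>x - (of_int i - 1 / 2)\<bar> \<le> 1 / 2" for x :: real and i
  proof -
    have "(\<exists>t. x = of_int i - t \<and> 0 \<le> t \<and> t \<le> 1) \<longleftrightarrow> 0 \<le> of_int i - x \<and> of_int i - x \<le> 1"
      by (auto intro!: exI[of _ "of_int i - x"])
    also have "\<dots> \<longleftrightarrow> \<bar>x - (of_int i - 1 / 2)\<bar> \<le> 1 / 2" unfolding abs_le_iff by argo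
    finally show ?thesis .
  qed
  then show ?thesis unfolding game_pattern_def mem_Collect_eq prod.inject by blast
qed

text \<open>The linear map to \<open>(x + y, x - y)\<close> is a 45 degree rotation composed with a
  reflection and a stretch by \<open>sqrt 2\<close>; hence the ratio
  \<open>sqrt 2 / k\<close>.\<close>

lemma similarity_rotation:
  fixes k c :: real
  assumes "k > 0"
  shows "similarity (\<lambda>(x, y). ((x + y - c) / k, (x - y) / k))" (is "similarity ?f")
  unfolding similarity_def
proof
  let ?g = "\<lambda>(u, v). ((k * u + k * v + c) / 2, (k * u - k * v + c) / 2)"
  show "bij ?f"
    by (rule o_bij[of ?g]) (use assms in \<open>auto simp: fun_eq_iff field_simps\<close>)
  have "dist (?f p) (?f q) = sqrt 2 / k * dist p q" for p q
  proof -
    obtain x y x' y' where pq: "p = (x, y)" "q = (x', y')" by (cases p, cases q) auto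
    have eq: "((x + y - c) / k - (x' + y' - c) / k)\<^sup>2 + ((x - y) / k - (x' - y') / k)\<^sup>2
      = 2 / k\<^sup>2 * ((x - x')\<^sup>2 + (y - y')\<^sup>2)"
      using assms by (simp add: field_simps power2_eq_square)
    have "sqrt (2 / k\<^sup>2 * t) = sqrt 2 / k * sqrt t" for t
      using assms by (simp add: real_sqrt_mult real_sqrt_divide)
    then show ?thesis
      by (simp only: pq prod.case dist_Pair_Pair dist_real_def power2_abs eq)
  qed
  then show "\<exists>k>0. \<forall>p q. dist (?f p) (?f q) = k * dist p q"
    using assms by (intro exI[of _ "sqrt 2 / k"]) auto
qed

theorem theorem6:
  fixes n :: nat and m :: int
  assumes "0 < m" and "m \<le> 2 ^ n"
  shows "similar (game_pattern m) (horizontal_section n m)"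
proof -
  \<comment> \<open>Subtracting \<open>m\<close> sends the centre \<open>(m/2, m/2)\<close> of the
    bar to the origin. The cell centre \<open>(i - 1/2, j - 1/2)\<close> goes to
    \<open>(i + j - 1 - m, i - j) / 2^n\<close>, as \<open>centres_section_iff\<close>
    requires.\<close>
  define f :: "real \<times> real \<Rightarrow> real \<times> real"
    where "f = (\<lambda>(x, y). ((x + y - of_int m) / 2 ^ n, (x - y) / 2 ^ n))"
  have sim: "similarity f" unfolding f_def by (rule similarity_rotation) simp
  have iff: "f (x, y) \<in> horizontal_section n m \<longleftrightarrow> (x, y) \<in> game_pattern m" for x y
  proof -
    have square: "\<bar>x + y - of_int m - of_int (i + j - 1 - m)\<bar> + \<bar>x - y - of_int (i - j)\<bar> \<le> 1 \<longleftrightarrow>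
        \<bar>x - (of_int i - 1 / 2)\<bar> \<le> 1 / 2 \<and> \<bar>y - (of_int j - 1 / 2)\<bar> \<le> 1 / 2" for i j
      using diamond_square_iff[of "x - (of_int i - 1 / 2)" "y - (of_int j - 1 / 2)"]
      by (simp add: algebra_simps)
    have cancel: "2 ^ n * (t / 2 ^ n) = t" for t :: real by simp
    show ?thesis
      unfolding f_def prod.case mem_horizontal_section_iff[OF assms] mem_game_pattern_iff
        centres_section_iff[OF assms] cancel square [symmetric] by blast
  qed
  have "p \<in> game_pattern m \<longleftrightarrow> f p \<in> horizontal_section n m" for p
    using iff by (cases p) simp
  then have "game_pattern m = f -` horizontal_section n m" by blast
  moreover have "surj f" using sim by (simp add: similarity_def bij_def)
  ultimately have "f ` game_pattern m = horizontal_section n m" by (simp only: surj_image_vimage_eq)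
  then show ?thesis unfolding similar_def using sim by blast
qed

end
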